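(* Let $\mathcal{X}\subseteq\mathbb{R}^d$ be closed and convex, let $f$ be $\mu$-strongly convex on $\mathcal{X}$ ($\mu>0$) with unique minimizer $x^*$ over $\mathcal{X}$, and suppose the stochastic gradient oracle is unbiased and bounded by $G^2$. Run projected SGD with step decay step-size with $T>1$ iterations, decay factor $\alpha>1$, inner-loop size $S=T/\log_\alpha T$, outer-loop size $N=T/S=\log_\alpha T$, $x_1^1\in\mathcal{X}$, and initial step-size $0<\eta_0<1/(2\mu)$. Then $$\mathbb{E}\|x_{S+1}^N-x^*\|^2\le\frac{R}{\exp\left(A_3\frac{T-1}{\ln T}\right)}+\frac{\alpha\,\eta_0\,G^2\exp\left(\frac{A_3}{\ln T}\right)}{2\mu A_3}\cdot\frac{\ln T}{T},$$ where $A_3=2\mu\eta_0\alpha\ln\alpha/(\alpha-1)$ and $R=\|x_1^1-x^*\|^2$. Further, if $f$ is $L$-smooth with respect to $x^*$, then $$\mathbb{E}[f(x_{S+1}^N)-f(x^* )]\le\frac L2\,\mathbb{E}\|x_{S+1}^N-x^*\|^2.$$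
   Context: $\|\cdot\|$ is the Euclidean norm, $\partial f(x)$ the subdifferential. $f$ is $\mu$-strongly convex on $\mathcal{X}$ if $f(y)\ge f(x)+\langle g,y-x\rangle+\frac\mu2\|y-x\|^2$ for all $x,y\in\mathcal{X}$, $g\in\partial f(x)$. $f$ is $L$-smooth with respect to $x^*$ ($L>0$) if $f(x)-f(x^* )\le\frac L2\|x-x^*\|^2$ for all $x\in\mathcal{X}$. Stochastic gradient oracle: queried at $x\in\mathcal{X}$ it returns a random vector $\hat g$ which (conditionally on the past of the algorithm) satisfies $\mathbb{E}[\hat g]=g$ for some $g\in\partial f(x)$. It is bounded by $G^2$ ($G>0$ fixed) if for every input, $\mathbb{E}[\|\hat g\|^2]\le G^2$. Projected SGD with step decay step-size. Inputs: $x_1^1$, $\eta_0$, $\alpha>1$, $T$, $S$, $N=T/S$. For $t=1,\dots,N$: set $\eta_t=\eta_0/\alpha^{t-1}$; for $i=1,\dots,S$: query the oracle at $x_i^t$ to obtain $\hat g_i^t$ and set $x_{i+1}^t=\Pi_{\mathcal{X}}(x_i^t-\eta_t\hat g_i^t)$, where $\Pi_{\mathcal{X}}$ is the Euclidean projection onto $\mathcal{X}$; then set $x_1^{t+1}=x_{S+1}^t$. Standing convention: $S$ and $N$ are assumed to be (positive) integers. *)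

theory Defs
  imports "HOL-Probability.Probability"
begin

text \<open>
  The objective is a real function on a closed convex set \<open>X\<close>; only its values on \<open>X\<close> matter.
  In particular subgradients are taken relative to \<open>X\<close>.
\<close>

definition subdifferential :: "('a::euclidean_space) set \<Rightarrow> ('a \<Rightarrow> real) \<Rightarrow> 'a \<Rightarrow> 'a set" where
  "subdifferential X f x = {g. \<forall>y\<in>X. f y \<ge> f x + g \<bullet> (y - x)}"

definition strongly_convex_on :: "('a::euclidean_space) set \<Rightarrow> ('a \<Rightarrow> real) \<Rightarrow> real \<Rightarrow> bool" where
  "strongly_convex_on X f \<mu> \<longleftrightarrow>
     (\<forall>x\<in>X. \<forall>y\<in>X. \<forall>g\<in>subdifferential X f x.
        f y \<ge> f x + g \<bullet> (y - x) + \<mu> / 2 * (norm (y - x))\<^sup>2)"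

definition smooth_wrt :: "('a::euclidean_space) set \<Rightarrow> ('a \<Rightarrow> real) \<Rightarrow> real \<Rightarrow> 'a \<Rightarrow> bool" where
  "smooth_wrt X f L xs \<longleftrightarrow> (\<forall>x\<in>X. f x - f xs \<le> L / 2 * (norm (x - xs))\<^sup>2)"

definition step_decay :: "real \<Rightarrow> real \<Rightarrow> nat \<Rightarrow> real" where
  "step_decay \<eta>0 \<alpha> t = \<eta>0 / \<alpha> ^ (t - 1)"

text \<open>
  Loop indices start at 1: \<open>g t i\<close> is the oracle's answer to the query at the iterate \<open>x t i\<close>,
  where \<open>1 \<le> t \<le> N\<close> and \<open>1 \<le> i \<le> S\<close>.
  The values of \<open>x\<close> and \<open>g\<close> at all other indices are irrelevant, except for \<open>x t (S + 1)\<close> and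
  \<open>x (N + 1) 1\<close>.
\<close>

definition step_decay_sgd ::
  "'w measure \<Rightarrow> ('a::euclidean_space) set \<Rightarrow> 'a \<Rightarrow> real \<Rightarrow> real \<Rightarrow> nat \<Rightarrow> nat
    \<Rightarrow> (nat \<Rightarrow> nat \<Rightarrow> 'w \<Rightarrow> 'a) \<Rightarrow> (nat \<Rightarrow> nat \<Rightarrow> 'w \<Rightarrow> 'a) \<Rightarrow> bool" where
  "step_decay_sgd M X x1 \<eta>0 \<alpha> N S g x \<longleftrightarrow>
     (\<forall>\<omega>\<in>space M.
        x 1 1 \<omega> = x1 \<and>
        (\<forall>t\<in>{1..N}. \<forall>i\<in>{1..S}.
           x t (i + 1) \<omega> = closest_point X (x t i \<omega> - step_decay \<eta>0 \<alpha> t *\<^sub>R g t i \<omega>)) \<and>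
        (\<forall>t\<in>{1..N}. x (t + 1) 1 \<omega> = x t (S + 1) \<omega>))"

text \<open>
  The information available when query \<open>(t, i)\<close> is made: the \<open>\<sigma>\<close>-algebra generated by the oracle's
  answers to all earlier queries.  As the starting point is deterministic, these determine all
  iterates up to and including \<open>x t i\<close>.
\<close>

definition past :: "'w measure \<Rightarrow> nat \<Rightarrow> (nat \<Rightarrow> nat \<Rightarrow> 'w \<Rightarrow> 'a::euclidean_space)
    \<Rightarrow> nat \<Rightarrow> nat \<Rightarrow> 'w measure" where
  "past M S g t i = sigma (space M)
     {g s j -` B \<inter> space M | s j B.
        (1 \<le> s \<and> s < t \<and> 1 \<le> j \<and> j \<le> S \<or> s = t \<and> 1 \<le> j \<and> j < i) \<and> B \<in> sets borel}"

text \<open>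
  \<open>Z\<close> is a version of the conditional expectation of \<open>Y\<close> given \<open>F\<close>.  The constant
  \<^const>\<open>real_cond_exp\<close> only covers real-valued random variables.
\<close>

definition has_cond_exp ::
  "'w measure \<Rightarrow> 'w measure \<Rightarrow> ('w \<Rightarrow> 'a::euclidean_space) \<Rightarrow> ('w \<Rightarrow> 'a) \<Rightarrow> bool" where
  "has_cond_exp M F Y Z \<longleftrightarrow>
     integrable M Y \<and> integrable M Z \<and> Z \<in> borel_measurable F \<and>
     (\<forall>A\<in>sets F. (LINT \<omega>:A|M. Y \<omega>) = (LINT \<omega>:A|M. Z \<omega>))"

text \<open>
  The oracle can be queried at every point of \<open>X\<close>, and the mean of its answer is then a subgradient
  there; hence there is a subgradient at every point of \<open>X\<close>, not only at the iterates.  Which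
  subgradient the mean is may depend on the past.
\<close>

definition unbiased_oracle ::
  "'w measure \<Rightarrow> ('a::euclidean_space) set \<Rightarrow> ('a \<Rightarrow> real) \<Rightarrow> nat \<Rightarrow> nat
    \<Rightarrow> (nat \<Rightarrow> nat \<Rightarrow> 'w \<Rightarrow> 'a) \<Rightarrow> (nat \<Rightarrow> nat \<Rightarrow> 'w \<Rightarrow> 'a) \<Rightarrow> bool" where
  "unbiased_oracle M X f N S x g \<longleftrightarrow>
     (\<forall>z\<in>X. subdifferential X f z \<noteq> {}) \<and>
     (\<forall>t\<in>{1..N}. \<forall>i\<in>{1..S}.
        g t i \<in> borel_measurable M \<and>
        (\<exists>h. has_cond_exp M (past M S g t i) (g t i) h \<and>
             (AE \<omega> in M. h \<omega> \<in> subdifferential X f (x t i \<omega>))))"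

text \<open>
  The second-moment bound holds for every input, that is, conditionally on the past.
  Integrability is explicit because \<^const>\<open>real_cond_exp\<close> is meaningless without it.
\<close>

definition bounded_oracle ::
  "'w measure \<Rightarrow> nat \<Rightarrow> nat \<Rightarrow> (nat \<Rightarrow> nat \<Rightarrow> 'w \<Rightarrow> 'a::euclidean_space) \<Rightarrow> real \<Rightarrow> bool" where
  "bounded_oracle M N S g G \<longleftrightarrow>
     (\<forall>t\<in>{1..N}. \<forall>i\<in>{1..S}.
        integrable M (\<lambda>\<omega>. (norm (g t i \<omega>))\<^sup>2) \<and>
        (AE \<omega> in M. real_cond_exp M (past M S g t i) (\<lambda>\<omega>. (norm (g t i \<omega>))\<^sup>2) \<omega> \<le> G\<^sup>2))"

end

theory Submission imports Defs begin

text \<open>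
  Nonexpansiveness of the projection and strong convexity, applied at \<open>x\<close> and, with the subgradient
  \<open>0\<close>, at the minimizer, give the recursion \<open>D' \<le> (1 - 2 \<mu> \<eta>) D + \<eta>\<^sup>2 G\<^sup>2\<close> for the mean squared
  distance, that is, \<open>D - G\<^sup>2 \<eta> / (2 \<mu>)\<close> contracts by \<open>1 - 2 \<mu> \<eta> \<le> exp (- 2 \<mu> \<eta>)\<close> in each step.
  Put \<open>w t = 2 \<mu> S \<eta>\<^sub>t / (\<alpha> - 1)\<close>, so that \<open>w (t - 1) - w t = 2 \<mu> S \<eta>\<^sub>t\<close> is the total exponent of
  epoch \<open>t\<close>, and \<open>C = G\<^sup>2 (\<alpha> - 1) / (4 \<mu>\<^sup>2 S)\<close>, so that \<open>G\<^sup>2 \<eta>\<^sub>t / (2 \<mu>) = C w t\<close>.  By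
  \<open>(1 + v) exp (- v) \<le> 1\<close>, the bound \<open>R exp (w t - w 0) + C (1 + w t)\<close> is preserved by every epoch;
  finally \<open>1 + w N \<le> exp (w N)\<close>.

  Bounding the noise of each epoch by the full geometric series \<open>1 / (2 \<mu> \<eta>\<^sub>t)\<close> would not be enough:
  this loses a factor of order \<open>1 / ln \<alpha>\<close> as \<open>\<alpha>\<close> tends to 1.
\<close>

section \<open>The filtration generated by the oracle's answers\<close>

lemma space_past [simp]: "space (past M S g t i) = space M"
  unfolding past_def by (rule space_measure_of) auto

lemma sets_past:
  "sets (past M S g t i) = sigma_sets (space M)
     {g s j -` B \<inter> space M | s j B.
        (1 \<le> s \<and> s < t \<and> 1 \<le> j \<and> j \<le> S \<or> s = t \<and> 1 \<le> j \<and> j < i) \<and> B \<in> sets borel}"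
  unfolding past_def by (rule sets_measure_of) auto

lemma measurable_past:
  assumes "1 \<le> s \<and> s < t \<and> 1 \<le> j \<and> j \<le> S \<or> s = t \<and> 1 \<le> j \<and> j < i"
  shows "g s j \<in> borel_measurable (past M S g t i)"
proof (rule measurableI)
  fix B :: "'b set" assume "B \<in> sets borel"
  then show "g s j -` B \<inter> space (past M S g t i) \<in> sets (past M S g t i)"
    unfolding sets_past space_past using assms by (intro sigma_sets.Basic) blast
qed simp

lemma subalgebra_past_mono:
  assumes "\<And>s j. 1 \<le> s \<and> s < t \<and> 1 \<le> j \<and> j \<le> S \<or> s = t \<and> 1 \<le> j \<and> j < i \<Longrightarrow>
    1 \<le> s \<and> s < t' \<and> 1 \<le> j \<and> j \<le> S \<or> s = t' \<and> 1 \<le> j \<and> j < i'"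
  shows "subalgebra (past M S g t' i') (past M S g t i)"
  unfolding subalgebra_def sets_past space_past
  by (intro conjI refl sigma_sets_mono') (use assms in blast)

lemma subalgebra_past_Suc: "subalgebra (past M S g t (Suc i)) (past M S g t i)"
  by (rule subalgebra_past_mono) auto

text \<open>No query is made between the end of an epoch and the start of the next, so the same
  answers are known at both. Only one inclusion is needed, to carry measurability of the iterate
  over the epoch boundary.\<close>

lemma subalgebra_past_next:
  assumes "1 \<le> t"
  shows "subalgebra (past M S g (Suc t) 1) (past M S g t (Suc S))"
  by (rule subalgebra_past_mono) (use assms in auto)

text \<open>\<open>past\<close> at index \<open>i\<close> involves the answers \<open>j < i\<close>
  of the current epoch. The bound \<open>i \<le> S + 1\<close> keeps these in the range where
  measurability is given, and still covers the iterate after the last query.\<close>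

lemma subalgebra_past:
  assumes "\<And>s j. s \<in> {1..N} \<Longrightarrow> j \<in> {1..S} \<Longrightarrow> g s j \<in> borel_measurable M"
    and "t \<in> {1..N}" "i \<le> S + 1"
  shows "subalgebra M (past M S g t i)"
  unfolding subalgebra_def sets_past space_past
  using assms by (auto intro!: sets.sigma_sets_subset measurable_sets[where A = borel])

section \<open>Conditional expectation of vector-valued answers\<close>

lemma integrable_mult_power2:
  fixes u v :: "'w \<Rightarrow> real"
  assumes [measurable]: "u \<in> borel_measurable M" "v \<in> borel_measurable M"
    and "integrable M (\<lambda>\<omega>. (u \<omega>)\<^sup>2)" "integrable M (\<lambda>\<omega>. (v \<omega>)\<^sup>2)"
  shows "integrable M (\<lambda>\<omega>. u \<omega> * v \<omega>)"
proof (rule Bochner_Integration.integrable_bound)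
  show "integrable M (\<lambda>\<omega>. (u \<omega>)\<^sup>2 + (v \<omega>)\<^sup>2)"
    using assms by simp
  have "\<bar>u \<omega> * v \<omega>\<bar> \<le> (u \<omega>)\<^sup>2 + (v \<omega>)\<^sup>2" for \<omega>
  proof -
    have "0 \<le> (\<bar>u \<omega>\<bar> - \<bar>v \<omega>\<bar>)\<^sup>2" by simp
    then have "2 * \<bar>u \<omega> * v \<omega>\<bar> \<le> (u \<omega>)\<^sup>2 + (v \<omega>)\<^sup>2"
      by (simp add: power2_diff abs_mult)
    then show ?thesis by linarith
  qed
  then show "AE \<omega> in M. norm (u \<omega> * v \<omega>) \<le> norm ((u \<omega>)\<^sup>2 + (v \<omega>)\<^sup>2)"
    by simp
qed simp

lemma integrable_inner_power2:
  fixes u :: "'w \<Rightarrow> 'a::euclidean_space"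
  assumes [measurable]: "u \<in> borel_measurable M"
    and "integrable M (\<lambda>\<omega>. (norm (u \<omega>))\<^sup>2)" and b: "b \<in> Basis"
  shows "integrable M (\<lambda>\<omega>. (u \<omega> \<bullet> b)\<^sup>2)"
proof (rule Bochner_Integration.integrable_bound[OF assms(2)])
  have "(u \<omega> \<bullet> b)\<^sup>2 \<le> (norm (u \<omega>))\<^sup>2" for \<omega>
    using power_mono[OF Basis_le_norm[OF b, of "u \<omega>"], of 2] by simp
  then show "AE \<omega> in M. norm ((u \<omega> \<bullet> b)\<^sup>2) \<le> norm ((norm (u \<omega>))\<^sup>2)"
    by simp
qed simp

text \<open>Reduces the vector-valued notion to real random variables, where the theory of
  \<open>real_cond_exp\<close> applies: a fixed inner product commutes with the integral over each
  set of \<open>F\<close>.\<close>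

lemma has_cond_exp_inner:
  fixes Y Z :: "'w \<Rightarrow> 'a::euclidean_space"
  assumes "has_cond_exp M F Y Z" and sub: "subalgebra M F"
  shows "has_cond_exp M F (\<lambda>\<omega>. Y \<omega> \<bullet> b) (\<lambda>\<omega>. Z \<omega> \<bullet> b)"
proof -
  note h = assms(1)[unfolded has_cond_exp_def]
  have "(LINT \<omega>:A|M. Y \<omega> \<bullet> b) = (LINT \<omega>:A|M. Z \<omega> \<bullet> b)" if A: "A \<in> sets F" for A
  proof -
    have AM: "A \<in> sets M" using A sub by (auto simp: subalgebra_def)
    have eq: "(LINT \<omega>:A|M. U \<omega> \<bullet> b) = (LINT \<omega>:A|M. U \<omega>) \<bullet> b" if "integrable M U" for U :: "'w \<Rightarrow> 'a"
      using integral_inner_left[of b M "\<lambda>\<omega>. indicator A \<omega> *\<^sub>R U \<omega>"]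
        integrable_mult_indicator[OF AM that]
      unfolding set_lebesgue_integral_def by simp
    show ?thesis using h A by (simp add: eq)
  qed
  then show ?thesis using h by (auto simp: has_cond_exp_def)
qed

text \<open>The known factor \<open>u\<close> is pulled out coordinate by coordinate. Square
  integrability of \<open>u\<close> and \<open>Y\<close> makes each coordinate product integrable,
  as \<open>real_cond_exp_intg\<close> requires. Integrability of the products with \<open>Z\<close>
  is inherited from those with \<open>real_cond_exp\<close>, to which the coordinates of
  \<open>Z\<close> are almost surely equal.\<close>

lemma (in prob_space) integral_inner_has_cond_exp:
  fixes Y Z u :: "'a \<Rightarrow> 'b::euclidean_space"
  assumes sub: "subalgebra M F" and ce: "has_cond_exp M F Y Z"
    and u: "u \<in> borel_measurable F"
    and u2: "integrable M (\<lambda>\<omega>. (norm (u \<omega>))\<^sup>2)" and Y2: "integrable M (\<lambda>\<omega>. (norm (Y \<omega>))\<^sup>2)"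
  shows "integrable M (\<lambda>\<omega>. u \<omega> \<bullet> Y \<omega>)" (is ?A) "integrable M (\<lambda>\<omega>. u \<omega> \<bullet> Z \<omega>)" (is ?B)
    "(\<integral>\<omega>. u \<omega> \<bullet> Y \<omega> \<partial>M) = (\<integral>\<omega>. u \<omega> \<bullet> Z \<omega> \<partial>M)" (is ?C)
proof -
  interpret finite_measure_subalgebra M F
    by unfold_locales (rule sub)
  have uM[measurable]: "u \<in> borel_measurable M"
    by (rule measurable_from_subalg[OF sub u])
  have YM[measurable]: "Y \<in> borel_measurable M" and ZM[measurable]: "Z \<in> borel_measurable M"
    using ce by (auto simp: has_cond_exp_def)
  have comp: "integrable M (\<lambda>\<omega>. (u \<omega> \<bullet> b) * (Y \<omega> \<bullet> b)) \<and>
      integrable M (\<lambda>\<omega>. (u \<omega> \<bullet> b) * (Z \<omega> \<bullet> b)) \<and>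
      (\<integral>\<omega>. (u \<omega> \<bullet> b) * (Y \<omega> \<bullet> b) \<partial>M) = (\<integral>\<omega>. (u \<omega> \<bullet> b) * (Z \<omega> \<bullet> b) \<partial>M)"
    if b: "b \<in> Basis" for b
  proof -
    have int: "integrable M (\<lambda>\<omega>. (u \<omega> \<bullet> b) * (Y \<omega> \<bullet> b))"
      by (intro integrable_mult_power2 integrable_inner_power2 u2 Y2 b) measurable
    have ub: "(\<lambda>\<omega>. u \<omega> \<bullet> b) \<in> borel_measurable F"
      using u by measurable
    have Yb: "(\<lambda>\<omega>. Y \<omega> \<bullet> b) \<in> borel_measurable M"
      by measurable
    have "has_cond_exp M F (\<lambda>\<omega>. Y \<omega> \<bullet> b) (\<lambda>\<omega>. Z \<omega> \<bullet> b)"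
      by (rule has_cond_exp_inner[OF ce sub])
    then have ae: "AE \<omega> in M. real_cond_exp M F (\<lambda>\<omega>. Y \<omega> \<bullet> b) \<omega> = Z \<omega> \<bullet> b"
      unfolding has_cond_exp_def by (intro real_cond_exp_charact) auto
    have ae': "AE \<omega> in M. (u \<omega> \<bullet> b) * real_cond_exp M F (\<lambda>\<omega>. Y \<omega> \<bullet> b) \<omega> = (u \<omega> \<bullet> b) * (Z \<omega> \<bullet> b)"
      using ae by eventually_elim simp
    have m1: "(\<lambda>\<omega>. (u \<omega> \<bullet> b) * real_cond_exp M F (\<lambda>\<omega>. Y \<omega> \<bullet> b) \<omega>) \<in> borel_measurable M"
      by measurable
    have m2: "(\<lambda>\<omega>. (u \<omega> \<bullet> b) * (Z \<omega> \<bullet> b)) \<in> borel_measurable M"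
      by measurable
    show ?thesis
      using int real_cond_exp_intg[OF int ub Yb] integrable_cong_AE[OF m1 m2 ae']
        integral_cong_AE[OF m1 m2 ae']
      by simp
  qed
  show ?A ?B
    unfolding euclidean_inner[of "u _" "Y _"] euclidean_inner[of "u _" "Z _"] using comp by simp_all
  show ?C
    unfolding euclidean_inner[of "u _" "Y _"] euclidean_inner[of "u _" "Z _"]
    using comp by (simp add: Bochner_Integration.integral_sum)
qed

section \<open>One projected stochastic gradient step\<close>

lemma strongly_convex_on_subgradient:
  assumes sc: "strongly_convex_on X f \<mu>" and m: "is_arg_min f (\<lambda>z. z \<in> X) xs"
    and z: "z \<in> X" and h: "h \<in> subdifferential X f z"
  shows "\<mu> * (norm (z - xs))\<^sup>2 \<le> (z - xs) \<bullet> h"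
proof -
  have xs: "xs \<in> X" and min: "\<And>y. y \<in> X \<Longrightarrow> f xs \<le> f y"
    using m by (auto simp: is_arg_min_linorder)
  have "f xs \<ge> f z + h \<bullet> (xs - z) + \<mu> / 2 * (norm (xs - z))\<^sup>2"
    using sc z xs h by (simp add: strongly_convex_on_def)
  \<comment> \<open>Subgradients are relative to \<open>X\<close>, so minimality over
    \<open>X\<close> suffices even if \<open>xs\<close> lies on the boundary. Adding the resulting
    inequality to the previous one cancels the function values, and the two halves of \<mu> add
    up.\<close>
  moreover have "0 \<in> subdifferential X f xs"
    using min by (simp add: subdifferential_def)
  then have "f z \<ge> f xs + 0 \<bullet> (z - xs) + \<mu> / 2 * (norm (z - xs))\<^sup>2"
    using sc z xs unfolding strongly_convex_on_def by blast
  moreover have "h \<bullet> (xs - z) = - ((z - xs) \<bullet> h)"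
    by (simp add: inner_diff inner_commute)
  ultimately show ?thesis by (simp add: norm_minus_commute)
qed

lemma (in prob_space) projected_sgd_step:
  fixes z \<gamma> h :: "'a \<Rightarrow> 'b::euclidean_space"
  assumes sub: "subalgebra M F" and X: "closed X" "convex X"
    and sc: "strongly_convex_on X f \<mu>" and min: "is_arg_min f (\<lambda>z. z \<in> X) xs"
    and z: "z \<in> borel_measurable F" "\<And>\<omega>. \<omega> \<in> space M \<Longrightarrow> z \<omega> \<in> X"
    and z2: "integrable M (\<lambda>\<omega>. (norm (z \<omega> - xs))\<^sup>2)"
    and ce: "has_cond_exp M F \<gamma> h" and sg: "AE \<omega> in M. h \<omega> \<in> subdifferential X f (z \<omega>)"
    and g2: "integrable M (\<lambda>\<omega>. (norm (\<gamma> \<omega>))\<^sup>2)"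
    and bd: "AE \<omega> in M. real_cond_exp M F (\<lambda>\<omega>. (norm (\<gamma> \<omega>))\<^sup>2) \<omega> \<le> G\<^sup>2"
    and \<eta>: "\<eta> > 0"
    and z': "\<And>\<omega>. \<omega> \<in> space M \<Longrightarrow> z' \<omega> = closest_point X (z \<omega> - \<eta> *\<^sub>R \<gamma> \<omega>)"
    and z'M: "z' \<in> borel_measurable M"
  shows "integrable M (\<lambda>\<omega>. (norm (z' \<omega> - xs))\<^sup>2)"
    and "(\<integral>\<omega>. (norm (z' \<omega> - xs))\<^sup>2 \<partial>M)
      \<le> (1 - 2 * \<mu> * \<eta>) * (\<integral>\<omega>. (norm (z \<omega> - xs))\<^sup>2 \<partial>M) + \<eta>\<^sup>2 * G\<^sup>2"
proof -
  interpret finite_measure_subalgebra M F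
    by unfold_locales (rule sub)
  have xs: "xs \<in> X" using min by (simp add: is_arg_min_def)
  then have ne: "X \<noteq> {}" by auto
  have u: "(\<lambda>\<omega>. z \<omega> - xs) \<in> borel_measurable F" using z(1) by measurable
  note ip = integral_inner_has_cond_exp[OF sub ce u z2 g2]
  \<comment> \<open>The squared distance to \<open>xs\<close> before projecting, expanded.
    Projection fixes \<open>xs\<close> and is nonexpansive, so \<open>Q\<close> dominates the new
    squared distance; this also yields its integrability.\<close>
  define Q where "Q \<omega> = (norm (z \<omega> - xs))\<^sup>2 - 2 * \<eta> * ((z \<omega> - xs) \<bullet> \<gamma> \<omega>) + \<eta>\<^sup>2 * (norm (\<gamma> \<omega>))\<^sup>2" for \<omega>
  have Qint: "integrable M Q" unfolding Q_def using z2 g2 ip(1) by simp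
  have le: "(norm (z' \<omega> - xs))\<^sup>2 \<le> Q \<omega>" if "\<omega> \<in> space M" for \<omega>
  proof -
    have "norm (z' \<omega> - xs) \<le> norm (z \<omega> - \<eta> *\<^sub>R \<gamma> \<omega> - xs)"
      using closest_point_lipschitz[OF X(2,1) ne, of "z \<omega> - \<eta> *\<^sub>R \<gamma> \<omega>" xs] xs
      by (simp add: dist_norm z'[OF that] closest_point_self)
    then have "(norm (z' \<omega> - xs))\<^sup>2 \<le> (norm ((z \<omega> - xs) - \<eta> *\<^sub>R \<gamma> \<omega>))\<^sup>2"
      by (intro power_mono) (auto simp: algebra_simps)
    also have "\<dots> = Q \<omega>"
      unfolding Q_def power2_norm_eq_inner
      by (simp add: inner_diff inner_commute power2_eq_square algebra_simps)
    finally show ?thesis .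
  qed
  show i': "integrable M (\<lambda>\<omega>. (norm (z' \<omega> - xs))\<^sup>2)"
  proof (rule Bochner_Integration.integrable_bound[OF Qint])
    show "AE \<omega> in M. norm ((norm (z' \<omega> - xs))\<^sup>2) \<le> norm (Q \<omega>)"
      by (rule AE_I2) (use le in \<open>simp add: order.trans[OF _ abs_ge_self]\<close>)
    show "(\<lambda>\<omega>. (norm (z' \<omega> - xs))\<^sup>2) \<in> borel_measurable M"
      using z'M by measurable
  qed
  \<comment> \<open>\<open>z\<close> is known before the query, so under the integral the answer may
    be replaced by its conditional mean \<open>h\<close>, a subgradient to which strong convexity
    applies.\<close>
  have cross: "\<mu> * (\<integral>\<omega>. (norm (z \<omega> - xs))\<^sup>2 \<partial>M) \<le> (\<integral>\<omega>. (z \<omega> - xs) \<bullet> \<gamma> \<omega> \<partial>M)"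
  proof -
    have "AE \<omega> in M. \<mu> * (norm (z \<omega> - xs))\<^sup>2 \<le> (z \<omega> - xs) \<bullet> h \<omega>"
      using sg AE_space by eventually_elim (rule strongly_convex_on_subgradient[OF sc min z(2)])
    then have "(\<integral>\<omega>. \<mu> * (norm (z \<omega> - xs))\<^sup>2 \<partial>M) \<le> (\<integral>\<omega>. (z \<omega> - xs) \<bullet> h \<omega> \<partial>M)"
      using z2 ip(2) by (intro integral_mono_AE) auto
    then show ?thesis using ip(3) by simp
  qed
  have sq: "(\<integral>\<omega>. (norm (\<gamma> \<omega>))\<^sup>2 \<partial>M) \<le> G\<^sup>2"
  proof -
    have "(\<integral>\<omega>. real_cond_exp M F (\<lambda>\<omega>. (norm (\<gamma> \<omega>))\<^sup>2) \<omega> \<partial>M) \<le> (\<integral>\<omega>. G\<^sup>2 \<partial>M)"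
      using real_cond_exp_int(1)[OF g2] bd by (intro integral_mono_AE) auto
    then show ?thesis using real_cond_exp_int(2)[OF g2] by (simp add: prob_space)
  qed
  have "(\<integral>\<omega>. (norm (z' \<omega> - xs))\<^sup>2 \<partial>M) \<le> (\<integral>\<omega>. Q \<omega> \<partial>M)"
    by (rule integral_mono[OF i' Qint le])
  also have "\<dots> = (\<integral>\<omega>. (norm (z \<omega> - xs))\<^sup>2 \<partial>M) - 2 * \<eta> * (\<integral>\<omega>. (z \<omega> - xs) \<bullet> \<gamma> \<omega> \<partial>M)
      + \<eta>\<^sup>2 * (\<integral>\<omega>. (norm (\<gamma> \<omega>))\<^sup>2 \<partial>M)"
    unfolding Q_def using z2 g2 ip(1) by simp
  also have "\<dots> \<le> (\<integral>\<omega>. (norm (z \<omega> - xs))\<^sup>2 \<partial>M) - 2 * \<eta> * (\<mu> * (\<integral>\<omega>. (norm (z \<omega> - xs))\<^sup>2 \<partial>M))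
      + \<eta>\<^sup>2 * G\<^sup>2"
    using \<eta> cross sq by (intro add_mono diff_mono mult_left_mono) auto
  finally show "(\<integral>\<omega>. (norm (z' \<omega> - xs))\<^sup>2 \<partial>M)
      \<le> (1 - 2 * \<mu> * \<eta>) * (\<integral>\<omega>. (norm (z \<omega> - xs))\<^sup>2 \<partial>M) + \<eta>\<^sup>2 * G\<^sup>2"
    by (simp add: algebra_simps)
qed

section \<open>Real recursions within an epoch and across epochs\<close>

lemma affine_contraction_bound:
  fixes a :: "nat \<Rightarrow> real"
  assumes step: "\<And>i. i < S \<Longrightarrow> a (Suc i) \<le> (1 - c) * a i + c * b"
    and c: "0 \<le> c" "c \<le> 1" and u: "a 0 \<le> u" "b \<le> u"
  shows "a S \<le> b + exp (- (c * real S)) * (u - b)"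
proof -
  \<comment> \<open>\<open>b\<close> is the fixed point of the affine map, so the excess over it
    shrinks by \<open>1 - c\<close>. The start \<open>a 0\<close> may lie below \<open>b\<close>;
    measuring the excess from \<open>u\<close> keeps it nonnegative, so that the factor can later be
    enlarged to an exponential.\<close>
  have "a i \<le> b + (1 - c) ^ i * (u - b)" if "i \<le> S" for i
    using that
  proof (induction i)
    case 0
    then show ?case using u by simp
  next
    case (Suc i)
    have "a (Suc i) \<le> (1 - c) * a i + c * b"
      using step Suc.prems by simp
    also have "\<dots> \<le> (1 - c) * (b + (1 - c) ^ i * (u - b)) + c * b"
      using Suc c by (intro add_right_mono mult_left_mono) auto
    also have "\<dots> = b + (1 - c) ^ Suc i * (u - b)"
      by (simp add: algebra_simps)
    finally show ?case .
  qed
  then have "a S \<le> b + (1 - c) ^ S * (u - b)" by simp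
  moreover have "(1 - c) ^ S \<le> exp (- c) ^ S"
    using c exp_ge_add_one_self[of "- c"] by (intro power_mono) auto
  then have "(1 - c) ^ S \<le> exp (- (c * real S))"
    by (simp add: exp_of_nat_mult[symmetric] mult.commute)
  ultimately show ?thesis
    using u mult_right_mono[of "(1 - c) ^ S" "exp (- (c * real S))" "u - b"] by simp
qed

text \<open>The premise is stated for every upper bound \<open>u\<close> because \<open>D t\<close>
  itself may lie below the noise level \<open>C * w (Suc t)\<close>. In the induction
  \<open>u\<close> is the invariant at \<open>t\<close>, which never does.\<close>

lemma epoch_invariant:
  fixes D w :: "nat \<Rightarrow> real"
  assumes step: "\<And>t u. t < N \<Longrightarrow> D t \<le> u \<Longrightarrow> C * w (Suc t) \<le> u \<Longrightarrow>
      D (Suc t) \<le> C * w (Suc t) + exp (- (w t - w (Suc t))) * (u - C * w (Suc t))"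
    and w: "\<And>t. 0 \<le> w t" "\<And>t. w (Suc t) \<le> w t" and "C \<ge> 0" "R \<ge> 0" "D 0 \<le> R" "t \<le> N"
  shows "D t \<le> R * exp (w t - w 0) + C * (1 + w t)"
  using \<open>t \<le> N\<close>
proof (induction t)
  case 0
  have "0 \<le> C * (1 + w 0)" using w \<open>C \<ge> 0\<close> by simp
  then show ?case using \<open>D 0 \<le> R\<close> by simp
next
  case (Suc t)
  define v where "v = w t - w (Suc t)"
  define u where "u = R * exp (w t - w 0) + C * (1 + w t)"
  have "C * w (Suc t) \<le> C * (1 + w t)"
    using w(2)[of t] \<open>C \<ge> 0\<close> by (intro mult_left_mono) auto
  also have "\<dots> \<le> u" using \<open>R \<ge> 0\<close> by (simp add: u_def)
  finally have "D (Suc t) \<le> C * w (Suc t) + exp (- v) * (u - C * w (Suc t))"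
    using Suc unfolding v_def by (intro step) (auto simp: u_def)
  \<comment> \<open>The initial error telescopes. The noise part of \<open>u\<close> exceeds the new
    level by \<open>C * (1 + v)\<close>, and after contraction at most \<open>C\<close> of this
    excess is left, which restores the invariant.\<close>
  also have "exp (- v) * (u - C * w (Suc t)) = R * exp (w (Suc t) - w 0) + C * (exp (- v) * (1 + v))"
    by (simp add: u_def v_def exp_diff exp_minus field_simps)
  also have "C * (exp (- v) * (1 + v)) \<le> C * (exp (- v) * exp v)"
    using \<open>C \<ge> 0\<close> by (intro mult_left_mono) (auto simp: exp_ge_add_one_self)
  also have "exp (- v) * exp v = 1" by (simp add: exp_minus)
  finally show ?case using \<open>C \<ge> 0\<close> by (simp add: algebra_simps)
qed

section \<open>Measurability of the objective on \<open>X\<close>\<close>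

lemma borel_measurable_subdifferentiable:
  fixes f :: "'a::euclidean_space \<Rightarrow> real"
  assumes "\<And>z. z \<in> X \<Longrightarrow> subdifferential X f z \<noteq> {}"
  shows "f \<in> borel_measurable (restrict_space borel X)"
proof (subst borel_measurable_iff_greater, intro allI)
  fix c :: real
  \<comment> \<open>On \<open>X\<close>, \<open>f\<close> is the pointwise supremum of its affine
    minorants, attained at \<open>y\<close> by the one based at \<open>z = y\<close>. Hence the
    superlevel set is the trace on \<open>X\<close> of a union of open sets, which is open however
    large the family is.\<close>
  define U where "U = (\<Union>z\<in>X. \<Union>h\<in>subdifferential X f z. {y. c < f z + h \<bullet> (y - z)})"
  have "open U"
    unfolding U_def by (intro open_UN ballI open_Collect_less continuous_intros)
  have "y \<in> U \<longleftrightarrow> c < f y" if y: "y \<in> X" for y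
  proof
    assume "y \<in> U"
    then show "c < f y" using y by (force simp: U_def subdifferential_def)
  next
    assume "c < f y"
    moreover obtain h where "h \<in> subdifferential X f y" using assms[OF y] by auto
    ultimately show "y \<in> U" unfolding U_def using y by (intro UN_I[of y] UN_I[of h]) auto
  qed
  then have "{y \<in> space (restrict_space borel X). c < f y} = X \<inter> U"
    by (auto simp: space_restrict_space)
  then show "{y \<in> space (restrict_space borel X). c < f y} \<in> sets (restrict_space borel X)"
    using \<open>open U\<close> by (auto simp: sets_restrict_space)
qed

section \<open>The run of the algorithm, for arbitrary positive \<open>S\<close> and
  \<open>N\<close>\<close>

locale step_decay_run = prob_space M for M :: "'w measure" +
  fixes X :: "('a::euclidean_space) set" and f :: "'a \<Rightarrow> real"
    and g x :: "nat \<Rightarrow> nat \<Rightarrow> 'w \<Rightarrow> 'a" and xs x1 :: 'a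
    and \<mu> G \<alpha> \<eta>0 :: real and S N :: nat
  assumes X: "closed X" "convex X"
    and mu: "\<mu> > 0" and sc: "strongly_convex_on X f \<mu>"
    and min: "is_arg_min f (\<lambda>z. z \<in> X) xs"
    and unb: "unbiased_oracle M X f N S x g"
    and bnd: "bounded_oracle M N S g G"
    and alpha: "\<alpha> > 1" and SN: "S \<ge> 1" "N \<ge> 1"
    and x1: "x1 \<in> X"
    and eta0: "0 < \<eta>0" "\<eta>0 < 1 / (2 * \<mu>)"
    and run: "step_decay_sgd M X x1 \<eta>0 \<alpha> N S g x"
begin

text \<open>No step size exceeds \<eta>0, which is below \<open>1 / (2 * \<mu>)\<close>. The second
  bound keeps the contraction factor of each step nonnegative, as
  \<open>affine_contraction_bound\<close> requires.\<close>

lemma step_decay_bounds: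
  shows "0 < step_decay \<eta>0 \<alpha> t" and "2 * \<mu> * step_decay \<eta>0 \<alpha> t \<le> 1"
proof -
  have "1 \<le> \<alpha> ^ (t - 1)" using alpha by simp
  then have "step_decay \<eta>0 \<alpha> t \<le> \<eta>0"
    unfolding step_decay_def using eta0(1) by (simp add: divide_le_eq mult_le_cancel_left1)
  moreover have "2 * \<mu> * \<eta>0 \<le> 1" using eta0 mu by (simp add: field_simps)
  ultimately show "2 * \<mu> * step_decay \<eta>0 \<alpha> t \<le> 1"
    using mu mult_left_mono[of "step_decay \<eta>0 \<alpha> t" \<eta>0 "2 * \<mu>"] by linarith
  show "0 < step_decay \<eta>0 \<alpha> t" unfolding step_decay_def using alpha eta0 by simp
qed

lemma x_start: "\<omega> \<in> space M \<Longrightarrow> x 1 1 \<omega> = x1"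
  using run by (simp add: step_decay_sgd_def)

lemma x_step:
  assumes "\<omega> \<in> space M" "t \<in> {1..N}" "i \<in> {1..S}"
  shows "x t (Suc i) \<omega> = closest_point X (x t i \<omega> - step_decay \<eta>0 \<alpha> t *\<^sub>R g t i \<omega>)"
  using run assms unfolding step_decay_sgd_def Suc_eq_plus1 by blast

lemma x_next:
  assumes "\<omega> \<in> space M" "t \<in> {1..N}"
  shows "x (Suc t) 1 \<omega> = x t (Suc S) \<omega>"
  using run assms unfolding step_decay_sgd_def Suc_eq_plus1 by blast

lemma subalgebra_past_run: "t \<in> {1..N} \<Longrightarrow> i \<le> S + 1 \<Longrightarrow> subalgebra M (past M S g t i)"
  using unb by (intro subalgebra_past[where N = N]) (simp_all add: unbiased_oracle_def)

definition sq_dist :: "nat \<Rightarrow> nat \<Rightarrow> real" where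
  "sq_dist t i = (\<integral>\<omega>. (norm (x t i \<omega> - xs))\<^sup>2 \<partial>M)"

text \<open>What \<open>projected_sgd_step\<close> asks of the current iterate, bundled as induction
  hypothesis. Measurability refers to the past and not just to \<open>M\<close>, since the iterate
  has to come out of a conditional expectation.\<close>

definition admissible :: "nat \<Rightarrow> nat \<Rightarrow> bool" where
  "admissible t i \<longleftrightarrow> x t i \<in> borel_measurable (past M S g t i) \<and> (\<forall>\<omega>\<in>space M. x t i \<omega> \<in> X) \<and>
     integrable M (\<lambda>\<omega>. (norm (x t i \<omega> - xs))\<^sup>2)"

lemma admissible_step:
  assumes ti: "t \<in> {1..N}" "i \<in> {1..S}" and adm: "admissible t i"
  shows "admissible t (Suc i)"
    and "sq_dist t (Suc i)
      \<le> (1 - 2 * \<mu> * step_decay \<eta>0 \<alpha> t) * sq_dist t i + (step_decay \<eta>0 \<alpha> t)\<^sup>2 * G\<^sup>2"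
proof -
  let ?\<eta> = "step_decay \<eta>0 \<alpha> t" and ?F = "past M S g t i" and ?F' = "past M S g t (Suc i)"
  have ne: "X \<noteq> {}" using x1 by auto
  \<comment> \<open>The new iterate is a continuous function of the old one and of the current
    answer, both of which are known once query \<open>(t, i)\<close> is answered.\<close>
  have [measurable]: "x t i \<in> borel_measurable ?F'"
    using adm measurable_from_subalg[OF subalgebra_past_Suc] by (auto simp: admissible_def)
  have [measurable]: "g t i \<in> borel_measurable ?F'"
    using ti by (intro measurable_past) auto
  have [measurable]: "closest_point X \<in> borel_measurable borel"
    using continuous_on_closest_point[OF X(2,1) ne] by (rule borel_measurable_continuous_onI)
  have "(\<lambda>\<omega>. closest_point X (x t i \<omega> - ?\<eta> *\<^sub>R g t i \<omega>)) \<in> borel_measurable ?F'"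
    by measurable
  then have meas: "x t (Suc i) \<in> borel_measurable ?F'"
    by (subst measurable_cong[OF x_step[OF _ ti]]) auto
  have inX: "x t (Suc i) \<omega> \<in> X" if "\<omega> \<in> space M" for \<omega>
    using x_step[OF that ti] closest_point_in_set[OF X(1) ne] by simp
  obtain h where h: "has_cond_exp M ?F (g t i) h" "AE \<omega> in M. h \<omega> \<in> subdifferential X f (x t i \<omega>)"
    using unb ti unfolding unbiased_oracle_def by blast
  have b: "integrable M (\<lambda>\<omega>. (norm (g t i \<omega>))\<^sup>2)"
    "AE \<omega> in M. real_cond_exp M ?F (\<lambda>\<omega>. (norm (g t i \<omega>))\<^sup>2) \<omega> \<le> G\<^sup>2"
    using bnd ti unfolding bounded_oracle_def by blast+
  have sub: "subalgebra M ?F" "subalgebra M ?F'"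
    using ti by (auto intro: subalgebra_past_run)
  have x: "x t i \<in> borel_measurable ?F" "\<And>\<omega>. \<omega> \<in> space M \<Longrightarrow> x t i \<omega> \<in> X"
    "integrable M (\<lambda>\<omega>. (norm (x t i \<omega> - xs))\<^sup>2)"
    using adm by (auto simp: admissible_def)
  note s = projected_sgd_step[OF sub(1) X sc min x h b step_decay_bounds(1) x_step[OF _ ti]
      measurable_from_subalg[OF sub(2) meas]]
  show "admissible t (Suc i)" using meas inX s(1) by (simp add: admissible_def)
  show "sq_dist t (Suc i) \<le> (1 - 2 * \<mu> * ?\<eta>) * sq_dist t i + ?\<eta>\<^sup>2 * G\<^sup>2"
    using s(2) by (simp add: sq_dist_def)
qed

lemma admissible_epoch:
  assumes t: "t \<in> {1..N}" and "admissible t 1" and "i \<le> S"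
  shows "admissible t (Suc i)"
  using \<open>i \<le> S\<close>
proof (induction i)
  case 0
  then show ?case using assms by simp
next
  case (Suc i)
  then show ?case using admissible_step(1)[OF t, of "Suc i"] by simp
qed

lemma admissible_start: "admissible 1 1"
proof -
  have "x 1 1 \<in> borel_measurable (past M S g 1 1)"
    by (subst measurable_cong[OF x_start]) auto
  moreover have "integrable M (\<lambda>\<omega>. (norm (x 1 1 \<omega> - xs))\<^sup>2)"
    by (subst Bochner_Integration.integrable_cong[OF refl, where g = "\<lambda>_. (norm (x1 - xs))\<^sup>2"])
      (simp_all add: x_start del: One_nat_def)
  ultimately show ?thesis using x_start x1 by (simp add: admissible_def)
qed

lemma admissible_next:
  assumes t: "t \<in> {1..N}" and adm: "admissible t (Suc S)"
  shows "admissible (Suc t) 1"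
proof -
  have "x t (Suc S) \<in> borel_measurable (past M S g (Suc t) 1)"
    using adm t measurable_from_subalg[OF subalgebra_past_next] by (auto simp: admissible_def)
  then have "x (Suc t) 1 \<in> borel_measurable (past M S g (Suc t) 1)"
    by (subst measurable_cong[OF x_next[OF _ t]]) auto
  moreover have "integrable M (\<lambda>\<omega>. (norm (x (Suc t) 1 \<omega> - xs))\<^sup>2)"
    using adm
    by (subst Bochner_Integration.integrable_cong[OF refl, where g = "\<lambda>\<omega>. (norm (x t (Suc S) \<omega> - xs))\<^sup>2"])
      (simp_all add: admissible_def x_next[OF _ t] del: One_nat_def)
  ultimately show ?thesis using x_next[OF _ t] adm by (simp add: admissible_def)
qed

lemma admissible_first: "t < N \<Longrightarrow> admissible (Suc t) 1"
proof (induction t)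
  case 0
  then show ?case using admissible_start by simp
next
  case (Suc t)
  then show ?case
    using admissible_next[of "Suc t"] admissible_epoch[of "Suc t" S] by simp
qed

lemma sq_dist_next: "t \<in> {1..N} \<Longrightarrow> sq_dist (Suc t) 1 = sq_dist t (Suc S)"
  unfolding sq_dist_def by (intro Bochner_Integration.integral_cong) (simp_all add: x_next del: One_nat_def)

text \<open>The step size \<eta> is constant within an epoch, so
  \<open>affine_contraction_bound\<close> applies with \<open>c = 2 * \<mu> * \<eta>\<close> and
  \<open>b = G\<^sup>2 / (2 * \<mu>) * \<eta>\<close>, for which \<open>c * b\<close> is the noise
  term. Its time 0 is the iterate of index 1.\<close>

lemma sq_dist_epoch:
  assumes t: "t < N"
    and u: "sq_dist (Suc t) 1 \<le> u" "G\<^sup>2 / (2 * \<mu>) * step_decay \<eta>0 \<alpha> (Suc t) \<le> u"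
  shows "sq_dist (Suc (Suc t)) 1 \<le> G\<^sup>2 / (2 * \<mu>) * step_decay \<eta>0 \<alpha> (Suc t)
    + exp (- (2 * \<mu> * step_decay \<eta>0 \<alpha> (Suc t) * real S))
      * (u - G\<^sup>2 / (2 * \<mu>) * step_decay \<eta>0 \<alpha> (Suc t))"
proof -
  let ?\<eta> = "step_decay \<eta>0 \<alpha> (Suc t)"
  have t': "Suc t \<in> {1..N}" using t by simp
  have "sq_dist (Suc t) (Suc S) \<le> G\<^sup>2 / (2 * \<mu>) * ?\<eta>
    + exp (- (2 * \<mu> * ?\<eta> * real S)) * (u - G\<^sup>2 / (2 * \<mu>) * ?\<eta>)"
  proof (rule affine_contraction_bound[where a = "\<lambda>i. sq_dist (Suc t) (Suc i)"])
    fix i assume "i < S"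
    moreover have "admissible (Suc t) (Suc i)"
      using admissible_epoch[OF t' admissible_first[OF t]] \<open>i < S\<close> by simp
    ultimately have "sq_dist (Suc t) (Suc (Suc i))
        \<le> (1 - 2 * \<mu> * ?\<eta>) * sq_dist (Suc t) (Suc i) + ?\<eta>\<^sup>2 * G\<^sup>2"
      by (intro admissible_step(2)[OF t']) auto
    also have "?\<eta>\<^sup>2 * G\<^sup>2 = 2 * \<mu> * ?\<eta> * (G\<^sup>2 / (2 * \<mu>) * ?\<eta>)"
      using mu by (simp add: power2_eq_square)
    finally show "sq_dist (Suc t) (Suc (Suc i))
        \<le> (1 - 2 * \<mu> * ?\<eta>) * sq_dist (Suc t) (Suc i) + 2 * \<mu> * ?\<eta> * (G\<^sup>2 / (2 * \<mu>) * ?\<eta>)" .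
  qed (use u mu step_decay_bounds[of "Suc t"] in auto)
  then show ?thesis by (simp only: sq_dist_next[OF t'])
qed

text \<open>\<open>w\<close> avoids \<open>step_decay\<close>, whose truncated subtraction gives
  \<eta>0 instead of \<open>\<eta>0 * \<alpha>\<close> at index 0. Thus
  \<open>w t = \<alpha> * w (Suc t)\<close> holds from \<open>t = 0\<close> on, and dividing by
  \<open>\<alpha> - 1\<close> turns the exponent of an epoch into a difference of consecutive
  values.\<close>

lemma sq_dist_bound:
  defines "w \<equiv> \<lambda>t. 2 * \<mu> * real S * \<eta>0 * \<alpha> / ((\<alpha> - 1) * \<alpha> ^ t)"
    and "C \<equiv> G\<^sup>2 * (\<alpha> - 1) / (4 * \<mu>\<^sup>2 * real S)"
  shows "sq_dist N (Suc S) \<le> (norm (x1 - xs))\<^sup>2 * exp (w N - w 0) + C * (1 + w N)"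
proof -
  have \<eta>: "step_decay \<eta>0 \<alpha> (Suc t) = \<eta>0 / \<alpha> ^ t" for t
    by (simp add: step_decay_def)
  have Cw: "G\<^sup>2 / (2 * \<mu>) * step_decay \<eta>0 \<alpha> (Suc t) = C * w (Suc t)" for t
    unfolding C_def w_def \<eta> using mu alpha SN(1) by (simp add: field_simps power2_eq_square)
  have dw: "2 * \<mu> * step_decay \<eta>0 \<alpha> (Suc t) * real S = w t - w (Suc t)" for t
  proof -
    have "w t = \<alpha> * w (Suc t)" using alpha by (simp add: w_def)
    then have "w t - w (Suc t) = (\<alpha> - 1) * w (Suc t)" by (simp add: algebra_simps)
    also have "\<dots> = 2 * \<mu> * step_decay \<eta>0 \<alpha> (Suc t) * real S"
      unfolding w_def \<eta> using alpha by simp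
    finally show ?thesis by simp
  qed
  have "sq_dist (Suc N) 1 \<le> (norm (x1 - xs))\<^sup>2 * exp (w N - w 0) + C * (1 + w N)"
  \<comment> \<open>\<open>D t\<close> is the mean squared distance after \<open>t\<close> complete
    epochs, so \<open>D N\<close> belongs to the final iterate.\<close>
  proof (rule epoch_invariant[where D = "\<lambda>t. sq_dist (Suc t) 1"])
    show "0 \<le> w t" for t using mu eta0 alpha by (simp add: w_def)
    have "0 \<le> 2 * \<mu> * step_decay \<eta>0 \<alpha> (Suc t) * real S" for t
      using mu step_decay_bounds(1)[of "Suc t"] by simp
    then show "w (Suc t) \<le> w t" for t using dw[of t] by (metis diff_ge_0_iff_ge)
    have "sq_dist 1 1 = (\<integral>\<omega>. (norm (x1 - xs))\<^sup>2 \<partial>M)"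
      unfolding sq_dist_def by (intro Bochner_Integration.integral_cong) (simp_all add: x_start del: One_nat_def)
    then show "sq_dist (Suc 0) 1 \<le> (norm (x1 - xs))\<^sup>2" by (simp add: prob_space)
    show "sq_dist (Suc (Suc t)) 1 \<le> C * w (Suc t) + exp (- (w t - w (Suc t))) * (u - C * w (Suc t))"
      if "t < N" "sq_dist (Suc t) 1 \<le> u" "C * w (Suc t) \<le> u" for t u
      using sq_dist_epoch[OF that(1,2)] that(3) by (simp only: Cw dw)
  qed (use mu alpha in \<open>auto simp: C_def\<close>)
  then show ?thesis using sq_dist_next[of N] SN by simp
qed

lemma admissible_last: "admissible N (Suc S)"
proof -
  obtain n where n: "N = Suc n" using SN by (cases N) auto
  have "admissible N 1" using admissible_first[of n] unfolding n by simp
  then show ?thesis using SN by (intro admissible_epoch) simp_all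
qed

text \<open>The gap is nonnegative by minimality and at most a multiple of the squared distance by
  smoothness. This gives integrability first, and then the bound by monotonicity of the
  integral.\<close>

lemma smooth_gap:
  assumes sm: "smooth_wrt X f L xs"
  shows "integrable M (\<lambda>\<omega>. f (x N (Suc S) \<omega>) - f xs)"
    and "(\<integral>\<omega>. f (x N (Suc S) \<omega>) - f xs \<partial>M) \<le> L / 2 * sq_dist N (Suc S)"
proof -
  have X': "\<And>\<omega>. \<omega> \<in> space M \<Longrightarrow> x N (Suc S) \<omega> \<in> X"
    and int: "integrable M (\<lambda>\<omega>. (norm (x N (Suc S) \<omega> - xs))\<^sup>2)"
    using admissible_last by (auto simp: admissible_def)
  have "x N (Suc S) \<in> borel_measurable M"
    using admissible_last measurable_from_subalg[OF subalgebra_past_run[of N "Suc S"]] SN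
    by (auto simp: admissible_def)
  then have "x N (Suc S) \<in> measurable M (restrict_space borel X)"
    using X' by (intro measurable_restrict_space2) auto
  moreover have "f \<in> borel_measurable (restrict_space borel X)"
    using unb by (intro borel_measurable_subdifferentiable) (auto simp: unbiased_oracle_def)
  ultimately have meas: "(\<lambda>\<omega>. f (x N (Suc S) \<omega>)) \<in> borel_measurable M"
    by (rule measurable_compose)
  have le: "f (x N (Suc S) \<omega>) - f xs \<le> L / 2 * (norm (x N (Suc S) \<omega> - xs))\<^sup>2"
    and ge: "0 \<le> f (x N (Suc S) \<omega>) - f xs" if "\<omega> \<in> space M" for \<omega>
    using sm min X'[OF that] by (auto simp: smooth_wrt_def is_arg_min_linorder)
  have intL: "integrable M (\<lambda>\<omega>. L / 2 * (norm (x N (Suc S) \<omega> - xs))\<^sup>2)"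
    using int by simp
  show i: "integrable M (\<lambda>\<omega>. f (x N (Suc S) \<omega>) - f xs)"
  proof (rule Bochner_Integration.integrable_bound[OF intL])
    show "AE \<omega> in M. norm (f (x N (Suc S) \<omega>) - f xs) \<le> norm (L / 2 * (norm (x N (Suc S) \<omega> - xs))\<^sup>2)"
      by (rule AE_I2) (use le ge in fastforce)
  qed (use meas in simp)
  show "(\<integral>\<omega>. f (x N (Suc S) \<omega>) - f xs \<partial>M) \<le> L / 2 * sq_dist N (Suc S)"
    using integral_mono[OF i intL le] by (simp add: sq_dist_def)
qed

end

section \<open>Specialization to \<open>N = log \<alpha> T\<close> and
  \<open>S = T / N\<close>\<close>

theorem theorem5p1:
  fixes M :: "'w measure"
    and X :: "('a::euclidean_space) set"
    and f :: "'a \<Rightarrow> real"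
    and g x :: "nat \<Rightarrow> nat \<Rightarrow> 'w \<Rightarrow> 'a"
    and xs x1 :: 'a
    and \<mu> G \<alpha> \<eta>0 A3 R :: real
    and T S N :: nat
  assumes "prob_space M"
    and "closed X" and "convex X"
    and "\<mu> > 0" and "strongly_convex_on X f \<mu>"
    and "is_arg_min f (\<lambda>z. z \<in> X) xs"
    and "\<And>z. is_arg_min f (\<lambda>z. z \<in> X) z \<Longrightarrow> z = xs"
    and "G > 0"
    and "unbiased_oracle M X f N S x g"
    and "bounded_oracle M N S g G"
    and "\<alpha> > 1" and "T > 1"
    and "real S = real T / log \<alpha> (real T)"
    and "real N = log \<alpha> (real T)"
    and "x1 \<in> X"
    and "0 < \<eta>0" and "\<eta>0 < 1 / (2 * \<mu>)"
    and "step_decay_sgd M X x1 \<eta>0 \<alpha> N S g x"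
    and "A3 = 2 * \<mu> * \<eta>0 * \<alpha> * ln \<alpha> / (\<alpha> - 1)"
    and "R = (norm (x1 - xs))\<^sup>2"
  shows "integrable M (\<lambda>\<omega>. (norm (x N (S + 1) \<omega> - xs))\<^sup>2) \<and>
         (\<integral>\<omega>. (norm (x N (S + 1) \<omega> - xs))\<^sup>2 \<partial>M)
           \<le> R / exp (A3 * ((real T - 1) / ln (real T)))
             + \<alpha> * \<eta>0 * G\<^sup>2 * exp (A3 / ln (real T)) / (2 * \<mu> * A3) * (ln (real T) / real T) \<and>
         (\<forall>L>0. smooth_wrt X f L xs \<longrightarrow>
            integrable M (\<lambda>\<omega>. f (x N (S + 1) \<omega>) - f xs) \<and>
            (\<integral>\<omega>. f (x N (S + 1) \<omega>) - f xs \<partial>M)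
              \<le> L / 2 * (\<integral>\<omega>. (norm (x N (S + 1) \<omega> - xs))\<^sup>2 \<partial>M))"
proof -
  let ?l = "ln (real T)"
  note T = \<open>T > 1\<close> and \<alpha> = \<open>\<alpha> > 1\<close> and \<mu> = \<open>\<mu> > 0\<close> and \<eta>0 = \<open>0 < \<eta>0\<close>
    and A3 = assms(19) and R = assms(20)
  have l: "?l > 0" and la: "ln \<alpha> > 0" using T \<alpha> by simp_all
  have S: "real S = real T * ln \<alpha> / ?l" and N: "real N = ?l / ln \<alpha>"
    unfolding assms(13) assms(14) by (simp_all add: log_def)
  have "real S > 0" "real N > 0" unfolding S N using l la T by simp_all
  then have SN: "S \<ge> 1" "N \<ge> 1" by simp_all
  \<comment> \<open>With \<open>N = log \<alpha> T\<close> the decay over all epochs amounts to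
    exactly \<open>T\<close>. Hence \<open>w N\<close> is \<open>w 0 / T\<close>, which produces the
    \<open>T - 1\<close> in the exponent.\<close>
  have "\<alpha> ^ N = \<alpha> powr real N" using \<alpha> by (simp add: powr_realpow)
  also have "\<dots> = real T" unfolding assms(14) using \<alpha> T by simp
  finally have TN: "\<alpha> ^ N = real T" .
  interpret prob_space M by fact
  interpret step_decay_run M X f g x xs x1 \<mu> G \<alpha> \<eta>0 S N
    by unfold_locales (fact assms SN)+
  define C where "C = G\<^sup>2 * (\<alpha> - 1) / (4 * \<mu>\<^sup>2 * real S)"
  \<comment> \<open>The factors \<alpha> and \<eta>0 of the stated noise term cancel against those
    inside \<open>A3\<close>.\<close>
  have C: "C = \<alpha> * \<eta>0 * G\<^sup>2 / (2 * \<mu> * A3) * (?l / real T)"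
    unfolding C_def S A3 using \<alpha> \<mu> \<eta>0 T l la by (simp add: field_simps power2_eq_square)
  have w0: "2 * \<mu> * real S * \<eta>0 * \<alpha> / ((\<alpha> - 1) * \<alpha> ^ 0) = A3 * (real T / ?l)"
    unfolding S A3 by (simp add: mult_ac)
  have wN: "2 * \<mu> * real S * \<eta>0 * \<alpha> / ((\<alpha> - 1) * \<alpha> ^ N) = A3 / ?l"
    unfolding TN S A3 using T by (simp add: mult_ac)
  have "sq_dist N (Suc S) \<le> R * exp (A3 / ?l - A3 * (real T / ?l)) + C * (1 + A3 / ?l)"
    using sq_dist_bound unfolding w0 wN C_def R .
  also have "A3 / ?l - A3 * (real T / ?l) = - (A3 * ((real T - 1) / ?l))"
    by (simp add: diff_divide_distrib algebra_simps)
  also have "C * (1 + A3 / ?l) \<le> C * exp (A3 / ?l)"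
    using \<alpha> by (intro mult_left_mono) (simp_all add: C_def exp_ge_add_one_self)
  also have "R * exp (- (A3 * ((real T - 1) / ?l))) = R / exp (A3 * ((real T - 1) / ?l))"
    by (simp only: exp_minus divide_inverse)
  also have "C * exp (A3 / ?l)
      = \<alpha> * \<eta>0 * G\<^sup>2 * exp (A3 / ?l) / (2 * \<mu> * A3) * (?l / real T)"
    unfolding C by simp
  finally have "sq_dist N (Suc S) \<le> R / exp (A3 * ((real T - 1) / ?l))
      + \<alpha> * \<eta>0 * G\<^sup>2 * exp (A3 / ?l) / (2 * \<mu> * A3) * (?l / real T)"
    by simp
  then show ?thesis
    using admissible_last smooth_gap by (simp add: sq_dist_def admissible_def)
qed

end
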